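(* Let $T$ be a $\delta$-Jordan Lie supertriple system and $(V,\theta)$ a representation of $T$. Then $d^{3}d^{1}=0$ and $d^{4}d^{2}=0$; that is, $d^3(d^1f)=0$ for every homogeneous linear map $f:T\to V$, and $d^4(d^2 f)=0$ for every 2-cochain $f\in C^2_\delta(T,V)$.
   Context: A $\delta$-Jordan Lie supertriple system ($\delta\in\{1,-1\}$) is a $\mathbb{Z}_2$-graded vector space $T$ with a trilinear product $[\cdot,\cdot,\cdot]$ such that, for all homogeneous $a,b,c,d,e$ (with $|a|$ the degree of $a$): $|[a,b,c]|=|a|+|b|+|c|$; $[b,a,c]=-\delta(-1)^{|a||b|}[a,b,c]$; $(-1)^{|a||c|}[a,b,c]+(-1)^{|b||a|}[b,c,a]+(-1)^{|c||b|}[c,a,b]=0$; and $[a,b,[c,d,e]]=[[a,b,c],d,e]+(-1)^{|c|(|a|+|b|)}[c,[a,b,d],e]+\delta(-1)^{(|a|+|b|)(|c|+|d|)}[c,d,[a,b,e]]$. A representation is $(V,\theta)$, $V$ a $\mathbb{Z}_2$-graded space, $\theta:T\otimes T\to End(V)$ bilinear, such that with $D(a,b)=(-1)^{|a||b|}\theta(b,a)-\delta\theta(a,b)$, for homogeneous $a,b,c,d$: (R1) $(-1)^{(|a|+|b|)(|c|+|d|)}\theta(c,d)\theta(a,b)-\delta(-1)^{|a||b|+|d|(|c|+|a|)}\theta(b,d)\theta(a,c)-\theta(a,[b,c,d])+(-1)^{|a|(|b|+|c|)}D(b,c)\theta(a,d)=0$; (R2) $\delta(-1)^{(|a|+|b|)(|c|+|d|)}\theta(c,d)D(a,b)-\delta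 D(a,b)\theta(c,d)+\theta([a,b,c],d)+\delta(-1)^{|c|(|a|+|b|)}\theta(c,[a,b,d])=0$; (R3) $D([a,b,c],d)+(-1)^{|c|(|a|+|b|)}D(c,[a,b,d])-\delta D(a,b)D(c,d)+(-1)^{(|a|+|b|)(|c|+|d|)}D(c,d)D(a,b)=0$. A 2-cochain is a homogeneous bilinear map $f:T\times T\to V$ with $f(y,x)=-\delta(-1)^{|x||y|}f(x,y)$. For homogeneous multilinear maps $f$ of degree $|f|$ into $V$ (all $x_i,y$ homogeneous in $T$), define: $d^{1}f(x_1,x_2,x_3)=(-1)^{(|f|+|x_1|)(|x_2|+|x_3|)}\theta(x_2,x_3)f(x_1)-f([x_1,x_2,x_3])+\delta(-1)^{|f|(|x_1|+|x_2|)}D(x_1,x_2)f(x_3)-\delta(-1)^{|x_2||x_3|+|f|(|x_1|+|x_3|)}\theta(x_1,x_3)f(x_2)$ for linear $f$; $d^{2}f(y,x_1,x_2,x_3)=(-1)^{(|f|+|y|+|x_1|)(|x_2|+|x_3|)}\theta(x_2,x_3)f(y,x_1)-f(y,[x_1,x_2,x_3])-\delta(-1)^{|x_2||x_3|+(|f|+|y|)(|x_1|+|x_3|)}\theta(x_1,x_3)f(y,x_2)+\delta(-1)^{(|f|+|y|)(|x_1|+|x_2|)}D(x_1,x_2)f(y,x_3)$ for bilinear $f$; $d^{3}f(x_1,\dots,x_5)=(-1)^{(|f|+|x_1|+|x_2|+|x_3|)(|x_4|+|x_5|)}\theta(x_4,x_5)f(x_1,x_2,x_3)-\delta(-1)^{(|f|+|x_1|+|x_2|)(|x_3|+|x_5|)+|x_4||x_5|}\theta(x_3,x_5)f(x_1,x_2,x_4)-\delta(-1)^{|f|(|x_1|+|x_2|)}D(x_1,x_2)f(x_3,x_4,x_5)+(-1)^{(|f|+|x_1|+|x_2|)(|x_3|+|x_4|)}D(x_3,x_4)f(x_1,x_2,x_5)+f([x_1,x_2,x_3],x_4,x_5)-f(x_1,x_2,[x_3,x_4,x_5])+(-1)^{|x_3|(|x_1|+|x_2|)}f(x_3,[x_1,x_2,x_4],x_5)+\delta(-1)^{(|x_1|+|x_2|)(|x_3|+|x_4|)}f(x_3,x_4,[x_1,x_2,x_5])$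 for trilinear $f$; $d^{4}f(y,x_1,\dots,x_5)=(-1)^{(|f|+|y|+|x_1|+|x_2|+|x_3|)(|x_4|+|x_5|)}\theta(x_4,x_5)f(y,x_1,x_2,x_3)-\delta(-1)^{(|f|+|y|+|x_1|+|x_2|)(|x_3|+|x_5|)+|x_4||x_5|}\theta(x_3,x_5)f(y,x_1,x_2,x_4)-\delta(-1)^{(|f|+|y|)(|x_1|+|x_2|)}D(x_1,x_2)f(y,x_3,x_4,x_5)+(-1)^{(|f|+|y|+|x_1|+|x_2|)(|x_3|+|x_4|)}D(x_3,x_4)f(y,x_1,x_2,x_5)+f(y,[x_1,x_2,x_3],x_4,x_5)-f(y,x_1,x_2,[x_3,x_4,x_5])+(-1)^{|x_3|(|x_1|+|x_2|)}f(y,x_3,[x_1,x_2,x_4],x_5)+\delta(-1)^{(|x_1|+|x_2|)(|x_3|+|x_4|)}f(y,x_3,x_4,[x_1,x_2,x_5])$ for 4-linear $f$. The degree of $d^nf$ is taken to be $|f|$. *)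

theory Defs
  imports Complex_Main
begin

definition sg :: "nat \<Rightarrow> 'k::comm_ring_1" where
  "sg n = (-1) ^ n"

definition subsp :: "('k::field \<Rightarrow> 'a::ab_group_add \<Rightarrow> 'a) \<Rightarrow> 'a set \<Rightarrow> bool" where
  "subsp sc S \<longleftrightarrow> 0 \<in> S \<and> (\<forall>x\<in>S. \<forall>y\<in>S. x + y \<in> S) \<and> (\<forall>c. \<forall>x\<in>S. sc c x \<in> S)"

definition graded_space :: "('k::field \<Rightarrow> 'a::ab_group_add \<Rightarrow> 'a) \<Rightarrow> (nat \<Rightarrow> 'a set) \<Rightarrow> bool" where
  "graded_space sc G \<longleftrightarrow> Vector_Spaces.vector_space sc \<and>
     subsp sc (G 0) \<and> subsp sc (G 1) \<and>
     G 0 \<inter> G 1 = {0} \<and> (\<forall>x. \<exists>u\<in>G 0. \<exists>w\<in>G 1. x = u + w)"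

text \<open>Homogeneous elements and their degree (0 or 1).  The zero vector is homogeneous of
  both degrees; all formulas below are multilinear, so the choice for 0 is immaterial.\<close>
definition hom :: "(nat \<Rightarrow> 'a set) \<Rightarrow> 'a \<Rightarrow> bool" where
  "hom G x \<longleftrightarrow> x \<in> G 0 \<or> x \<in> G 1"

definition deg :: "(nat \<Rightarrow> 'a set) \<Rightarrow> 'a \<Rightarrow> nat" where
  "deg G x = (if x \<in> G 1 then 1 else 0)"

definition JLSTS :: "('k::field \<Rightarrow> 'a::ab_group_add \<Rightarrow> 'a) \<Rightarrow> (nat \<Rightarrow> 'a set) \<Rightarrow> 'k
    \<Rightarrow> ('a \<Rightarrow> 'a \<Rightarrow> 'a \<Rightarrow> 'a) \<Rightarrow> bool" where
  "JLSTS sc G \<delta> br \<longleftrightarrow>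
     graded_space sc G \<and> (\<delta> = 1 \<or> \<delta> = -1) \<and>
     (\<forall>b c. Vector_Spaces.linear sc sc (\<lambda>a. br a b c)) \<and>
     (\<forall>a c. Vector_Spaces.linear sc sc (\<lambda>b. br a b c)) \<and>
     (\<forall>a b. Vector_Spaces.linear sc sc (\<lambda>c. br a b c)) \<and>
     (\<forall>a b c. hom G a \<longrightarrow> hom G b \<longrightarrow> hom G c \<longrightarrow>
        br a b c \<in> G ((deg G a + deg G b + deg G c) mod 2)) \<and>
     (\<forall>a b c. hom G a \<longrightarrow> hom G b \<longrightarrow> hom G c \<longrightarrow>
        br b a c = sc (- \<delta> * sg (deg G a * deg G b)) (br a b c)) \<and>
     (\<forall>a b c. hom G a \<longrightarrow> hom G b \<longrightarrow> hom G c \<longrightarrow>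
        sc (sg (deg G a * deg G c)) (br a b c) + sc (sg (deg G b * deg G a)) (br b c a)
        + sc (sg (deg G c * deg G b)) (br c a b) = 0) \<and>
     (\<forall>a b c d e. hom G a \<longrightarrow> hom G b \<longrightarrow> hom G c \<longrightarrow> hom G d \<longrightarrow> hom G e \<longrightarrow>
        br a b (br c d e) =
          br (br a b c) d e
          + sc (sg (deg G c * (deg G a + deg G b))) (br c (br a b d) e)
          + sc (\<delta> * sg ((deg G a + deg G b) * (deg G c + deg G d))) (br c d (br a b e)))"

definition Dop :: "('k::comm_ring_1 \<Rightarrow> 'v::ab_group_add \<Rightarrow> 'v) \<Rightarrow> (nat \<Rightarrow> 'a set) \<Rightarrow> 'k
    \<Rightarrow> ('a \<Rightarrow> 'a \<Rightarrow> 'v \<Rightarrow> 'v) \<Rightarrow> 'a \<Rightarrow> 'a \<Rightarrow> 'v \<Rightarrow> 'v" where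
  "Dop sv G \<delta> \<theta> a b v = sv (sg (deg G a * deg G b)) (\<theta> b a v) - sv \<delta> (\<theta> a b v)"

definition rep :: "('k::field \<Rightarrow> 'a::ab_group_add \<Rightarrow> 'a) \<Rightarrow> (nat \<Rightarrow> 'a set) \<Rightarrow> 'k
    \<Rightarrow> ('a \<Rightarrow> 'a \<Rightarrow> 'a \<Rightarrow> 'a)
    \<Rightarrow> ('k \<Rightarrow> 'v::ab_group_add \<Rightarrow> 'v) \<Rightarrow> (nat \<Rightarrow> 'v set) \<Rightarrow> ('a \<Rightarrow> 'a \<Rightarrow> 'v \<Rightarrow> 'v) \<Rightarrow> bool" where
  "rep sc G \<delta> br sv VG \<theta> \<longleftrightarrow>
     graded_space sv VG \<and>
     (\<forall>a b. Vector_Spaces.linear sv sv (\<theta> a b)) \<and>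
     (\<forall>b v. Vector_Spaces.linear sc sv (\<lambda>a. \<theta> a b v)) \<and>
     (\<forall>a v. Vector_Spaces.linear sc sv (\<lambda>b. \<theta> a b v)) \<and>
     (\<forall>a b c d v. hom G a \<longrightarrow> hom G b \<longrightarrow> hom G c \<longrightarrow> hom G d \<longrightarrow>
        sv (sg ((deg G a + deg G b) * (deg G c + deg G d))) (\<theta> c d (\<theta> a b v))
        - sv (\<delta> * sg (deg G a * deg G b + deg G d * (deg G c + deg G a))) (\<theta> b d (\<theta> a c v))
        - \<theta> a (br b c d) v
        + sv (sg (deg G a * (deg G b + deg G c))) (Dop sv G \<delta> \<theta> b c (\<theta> a d v)) = 0) \<and>
     (\<forall>a b c d v. hom G a \<longrightarrow> hom G b \<longrightarrow> hom G c \<longrightarrow> hom G d \<longrightarrow>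
        sv (\<delta> * sg ((deg G a + deg G b) * (deg G c + deg G d))) (\<theta> c d (Dop sv G \<delta> \<theta> a b v))
        - sv \<delta> (Dop sv G \<delta> \<theta> a b (\<theta> c d v))
        + \<theta> (br a b c) d v
        + sv (\<delta> * sg (deg G c * (deg G a + deg G b))) (\<theta> c (br a b d) v) = 0) \<and>
     (\<forall>a b c d v. hom G a \<longrightarrow> hom G b \<longrightarrow> hom G c \<longrightarrow> hom G d \<longrightarrow>
        Dop sv G \<delta> \<theta> (br a b c) d v
        + sv (sg (deg G c * (deg G a + deg G b))) (Dop sv G \<delta> \<theta> c (br a b d) v)
        - sv \<delta> (Dop sv G \<delta> \<theta> a b (Dop sv G \<delta> \<theta> c d v))
        + sv (sg ((deg G a + deg G b) * (deg G c + deg G d))) (Dop sv G \<delta> \<theta> c d (Dop sv G \<delta> \<theta> a b v)) = 0)"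

definition hom_linear :: "('k::field \<Rightarrow> 'a::ab_group_add \<Rightarrow> 'a) \<Rightarrow> (nat \<Rightarrow> 'a set)
    \<Rightarrow> ('k \<Rightarrow> 'v::ab_group_add \<Rightarrow> 'v) \<Rightarrow> (nat \<Rightarrow> 'v set) \<Rightarrow> ('a \<Rightarrow> 'v) \<Rightarrow> nat \<Rightarrow> bool" where
  "hom_linear sc G sv VG f df \<longleftrightarrow> df < 2 \<and> Vector_Spaces.linear sc sv f \<and>
     (\<forall>x. hom G x \<longrightarrow> f x \<in> VG ((deg G x + df) mod 2))"

definition cochain2 :: "('k::field \<Rightarrow> 'a::ab_group_add \<Rightarrow> 'a) \<Rightarrow> (nat \<Rightarrow> 'a set) \<Rightarrow> 'k
    \<Rightarrow> ('k \<Rightarrow> 'v::ab_group_add \<Rightarrow> 'v) \<Rightarrow> (nat \<Rightarrow> 'v set) \<Rightarrow> ('a \<Rightarrow> 'a \<Rightarrow> 'v) \<Rightarrow> nat \<Rightarrow> bool" where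
  "cochain2 sc G \<delta> sv VG f df \<longleftrightarrow> df < 2 \<and>
     (\<forall>y. Vector_Spaces.linear sc sv (\<lambda>x. f x y)) \<and>
     (\<forall>x. Vector_Spaces.linear sc sv (\<lambda>y. f x y)) \<and>
     (\<forall>x y. hom G x \<longrightarrow> hom G y \<longrightarrow> f x y \<in> VG ((deg G x + deg G y + df) mod 2)) \<and>
     (\<forall>x y. hom G x \<longrightarrow> hom G y \<longrightarrow> f y x = sv (- \<delta> * sg (deg G x * deg G y)) (f x y))"

text \<open>Coboundary operators (on homogeneous arguments); df is the degree of f,
  which is also the degree of d^n f.\<close>
definition d1 :: "('k::comm_ring_1 \<Rightarrow> 'v::ab_group_add \<Rightarrow> 'v) \<Rightarrow> (nat \<Rightarrow> 'a set) \<Rightarrow> 'k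
    \<Rightarrow> ('a \<Rightarrow> 'a \<Rightarrow> 'a \<Rightarrow> 'a) \<Rightarrow> ('a \<Rightarrow> 'a \<Rightarrow> 'v \<Rightarrow> 'v) \<Rightarrow> ('a \<Rightarrow> 'v) \<Rightarrow> nat
    \<Rightarrow> 'a \<Rightarrow> 'a \<Rightarrow> 'a \<Rightarrow> 'v" where
  "d1 sv G \<delta> br \<theta> f df x1 x2 x3 =
     sv (sg ((df + deg G x1) * (deg G x2 + deg G x3))) (\<theta> x2 x3 (f x1))
     - f (br x1 x2 x3)
     + sv (\<delta> * sg (df * (deg G x1 + deg G x2))) (Dop sv G \<delta> \<theta> x1 x2 (f x3))
     - sv (\<delta> * sg (deg G x2 * deg G x3 + df * (deg G x1 + deg G x3))) (\<theta> x1 x3 (f x2))"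

definition d2 :: "('k::comm_ring_1 \<Rightarrow> 'v::ab_group_add \<Rightarrow> 'v) \<Rightarrow> (nat \<Rightarrow> 'a set) \<Rightarrow> 'k
    \<Rightarrow> ('a \<Rightarrow> 'a \<Rightarrow> 'a \<Rightarrow> 'a) \<Rightarrow> ('a \<Rightarrow> 'a \<Rightarrow> 'v \<Rightarrow> 'v) \<Rightarrow> ('a \<Rightarrow> 'a \<Rightarrow> 'v) \<Rightarrow> nat
    \<Rightarrow> 'a \<Rightarrow> 'a \<Rightarrow> 'a \<Rightarrow> 'a \<Rightarrow> 'v" where
  "d2 sv G \<delta> br \<theta> f df y x1 x2 x3 =
     sv (sg ((df + deg G y + deg G x1) * (deg G x2 + deg G x3))) (\<theta> x2 x3 (f y x1))
     - f y (br x1 x2 x3)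
     - sv (\<delta> * sg (deg G x2 * deg G x3 + (df + deg G y) * (deg G x1 + deg G x3))) (\<theta> x1 x3 (f y x2))
     + sv (\<delta> * sg ((df + deg G y) * (deg G x1 + deg G x2))) (Dop sv G \<delta> \<theta> x1 x2 (f y x3))"

definition d3 :: "('k::comm_ring_1 \<Rightarrow> 'v::ab_group_add \<Rightarrow> 'v) \<Rightarrow> (nat \<Rightarrow> 'a set) \<Rightarrow> 'k
    \<Rightarrow> ('a \<Rightarrow> 'a \<Rightarrow> 'a \<Rightarrow> 'a) \<Rightarrow> ('a \<Rightarrow> 'a \<Rightarrow> 'v \<Rightarrow> 'v) \<Rightarrow> ('a \<Rightarrow> 'a \<Rightarrow> 'a \<Rightarrow> 'v) \<Rightarrow> nat
    \<Rightarrow> 'a \<Rightarrow> 'a \<Rightarrow> 'a \<Rightarrow> 'a \<Rightarrow> 'a \<Rightarrow> 'v" where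
  "d3 sv G \<delta> br \<theta> f df x1 x2 x3 x4 x5 =
     sv (sg ((df + deg G x1 + deg G x2 + deg G x3) * (deg G x4 + deg G x5))) (\<theta> x4 x5 (f x1 x2 x3))
     - sv (\<delta> * sg ((df + deg G x1 + deg G x2) * (deg G x3 + deg G x5) + deg G x4 * deg G x5)) (\<theta> x3 x5 (f x1 x2 x4))
     - sv (\<delta> * sg (df * (deg G x1 + deg G x2))) (Dop sv G \<delta> \<theta> x1 x2 (f x3 x4 x5))
     + sv (sg ((df + deg G x1 + deg G x2) * (deg G x3 + deg G x4))) (Dop sv G \<delta> \<theta> x3 x4 (f x1 x2 x5))
     + f (br x1 x2 x3) x4 x5
     - f x1 x2 (br x3 x4 x5)
     + sv (sg (deg G x3 * (deg G x1 + deg G x2))) (f x3 (br x1 x2 x4) x5)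
     + sv (\<delta> * sg ((deg G x1 + deg G x2) * (deg G x3 + deg G x4))) (f x3 x4 (br x1 x2 x5))"

definition d4 :: "('k::comm_ring_1 \<Rightarrow> 'v::ab_group_add \<Rightarrow> 'v) \<Rightarrow> (nat \<Rightarrow> 'a set) \<Rightarrow> 'k
    \<Rightarrow> ('a \<Rightarrow> 'a \<Rightarrow> 'a \<Rightarrow> 'a) \<Rightarrow> ('a \<Rightarrow> 'a \<Rightarrow> 'v \<Rightarrow> 'v) \<Rightarrow> ('a \<Rightarrow> 'a \<Rightarrow> 'a \<Rightarrow> 'a \<Rightarrow> 'v) \<Rightarrow> nat
    \<Rightarrow> 'a \<Rightarrow> 'a \<Rightarrow> 'a \<Rightarrow> 'a \<Rightarrow> 'a \<Rightarrow> 'a \<Rightarrow> 'v" where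
  "d4 sv G \<delta> br \<theta> f df y x1 x2 x3 x4 x5 =
     sv (sg ((df + deg G y + deg G x1 + deg G x2 + deg G x3) * (deg G x4 + deg G x5))) (\<theta> x4 x5 (f y x1 x2 x3))
     - sv (\<delta> * sg ((df + deg G y + deg G x1 + deg G x2) * (deg G x3 + deg G x5) + deg G x4 * deg G x5)) (\<theta> x3 x5 (f y x1 x2 x4))
     - sv (\<delta> * sg ((df + deg G y) * (deg G x1 + deg G x2))) (Dop sv G \<delta> \<theta> x1 x2 (f y x3 x4 x5))
     + sv (sg ((df + deg G y + deg G x1 + deg G x2) * (deg G x3 + deg G x4))) (Dop sv G \<delta> \<theta> x3 x4 (f y x1 x2 x5))
     + f y (br x1 x2 x3) x4 x5
     - f y x1 x2 (br x3 x4 x5)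
     + sv (sg (deg G x3 * (deg G x1 + deg G x2))) (f y x3 (br x1 x2 x4) x5)
     + sv (\<delta> * sg ((deg G x1 + deg G x2) * (deg G x3 + deg G x4))) (f y x3 x4 (br x1 x2 x5))"

end

theory Submission
  imports Defs
begin

text \<open>Fixing the first argument \<open>y\<close> of a 2-cochain \<open>f\<close> gives a linear map of degree
  \<open>|f| + |y|\<close>, and under this identification \<open>d\<^sup>2\<close> and \<open>d\<^sup>4\<close> become \<open>d\<^sup>1\<close> and \<open>d\<^sup>3\<close>.  So it suffices
  to show \<open>d\<^sup>3 d\<^sup>1 f = 0\<close>.  In the expansion of \<open>d\<^sup>3 d\<^sup>1 f (x\<^sub>1, \<dots>, x\<^sub>5)\<close> the terms in
  which an operator acts on \<open>f\<close> of a bracket cancel in pairs, the terms with two nested brackets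
  inside \<open>f\<close> vanish by the derivation identity, and the remaining terms containing
  \<open>f x\<^sub>1\<close>, \<open>f x\<^sub>2\<close>, \<open>f x\<^sub>3\<close>, \<open>f x\<^sub>4\<close>, \<open>f x\<^sub>5\<close> are, up to sign, instances of (R1), (R1), (R2), (R2)
  and (R3) respectively.\<close>

text \<open>Only parities matter: in this form each sign identity below becomes a finite check over
  the parities of the degrees.\<close>

lemma sg_eq_if: "(sg n :: 'k::comm_ring_1) = (if even n then 1 else - 1)"
  by (simp add: sg_def minus_one_power_iff)

lemma linear_rules:
  assumes "Vector_Spaces.linear s1 s2 g"
  shows "g (x + y) = g x + g y" and "g (x - y) = g x - g y" and "g (s1 c x) = s2 c (g x)"
    and "g 0 = 0"
proof -
  interpret Vector_Spaces.linear s1 s2 g by fact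
  show "g (x + y) = g x + g y" "g (x - y) = g x - g y" "g (s1 c x) = s2 c (g x)" "g 0 = 0"
    by (rule add diff scale zero)+
qed

locale JLSTS_rep =
  fixes sc :: "'k::field \<Rightarrow> 'a::ab_group_add \<Rightarrow> 'a"
    and sv :: "'k \<Rightarrow> 'v::ab_group_add \<Rightarrow> 'v"
    and G :: "nat \<Rightarrow> 'a set" and VG :: "nat \<Rightarrow> 'v set"
    and \<delta> :: 'k and br :: "'a \<Rightarrow> 'a \<Rightarrow> 'a \<Rightarrow> 'a" and \<theta> :: "'a \<Rightarrow> 'a \<Rightarrow> 'v \<Rightarrow> 'v"
  assumes JLSTS: "JLSTS sc G \<delta> br"
    and rep: "rep sc G \<delta> br sv VG \<theta>"
begin

abbreviation D :: "'a \<Rightarrow> 'a \<Rightarrow> 'v \<Rightarrow> 'v" where "D \<equiv> Dop sv G \<delta> \<theta>"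

abbreviation dg :: "'a \<Rightarrow> nat" where "dg \<equiv> deg G"

lemma delta_cases: "\<delta> = 1 \<or> \<delta> = -1"
  using JLSTS unfolding JLSTS_def by blast

sublocale V: vector_space sv
  using rep unfolding rep_def graded_space_def by blast

lemma br_zero [simp]: "br 0 b c = 0" "br a 0 c = 0" "br a b 0 = 0"
proof -
  have "Vector_Spaces.linear sc sc (\<lambda>a. br a b c)" "Vector_Spaces.linear sc sc (\<lambda>b. br a b c)"
    "Vector_Spaces.linear sc sc (\<lambda>c. br a b c)"
    using JLSTS unfolding JLSTS_def by blast+
  then show "br 0 b c = 0" "br a 0 c = 0" "br a b 0 = 0" by (auto dest: linear_rules(4))
qed

lemma theta_linear: "Vector_Spaces.linear sv sv (\<theta> a b)"
  using rep by (simp add: rep_def)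

lemmas theta_rules = linear_rules[OF theta_linear]

lemma theta_zero [simp]: "\<theta> 0 b v = 0" "\<theta> a 0 v = 0"
proof -
  have "Vector_Spaces.linear sc sv (\<lambda>a. \<theta> a b v)" "Vector_Spaces.linear sc sv (\<lambda>b. \<theta> a b v)"
    using rep by (simp add: rep_def)+
  then show "\<theta> 0 b v = 0" "\<theta> a 0 v = 0" by (auto dest: linear_rules(4))
qed

lemma D_rules:
  "D a b (u + v) = D a b u + D a b v" "D a b (u - v) = D a b u - D a b v"
  "D a b (sv c v) = sv c (D a b v)" "D a b 0 = 0"
  by (simp_all add: Dop_def theta_rules V.scale_right_distrib V.scale_right_diff_distrib mult.commute)

lemma D_zero [simp]: "D 0 b v = 0" "D a 0 v = 0"
  by (simp_all add: Dop_def)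

lemma br_in: "hom G a \<Longrightarrow> hom G b \<Longrightarrow> hom G c \<Longrightarrow> br a b c \<in> G ((dg a + dg b + dg c) mod 2)"
  using JLSTS unfolding JLSTS_def by blast

text \<open>The zero vector is homogeneous of both degrees but \<open>deg\<close> assigns it degree 1, so degrees of
  brackets are only controlled up to the following relation.\<close>

definition has_deg :: "nat \<Rightarrow> 'a \<Rightarrow> bool" where
  "has_deg p x \<longleftrightarrow> x = 0 \<or> even (p + dg x)"

lemma has_deg_dg: "has_deg (dg x) x"
  by (simp add: has_deg_def)

text \<open>Since \<open>G 0\<close> and \<open>G 1\<close> meet only in 0, a nonzero element of one
  of them has the parity of \<open>dg\<close> fixed by that membership.\<close>

lemma has_deg_br:
  assumes "hom G a" "hom G b" "hom G c"
  shows "has_deg (dg a + dg b + dg c) (br a b c)"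
proof -
  have "G 0 \<inter> G 1 = {0}"
    using JLSTS unfolding JLSTS_def graded_space_def by (elim conjE) assumption
  then have "x \<in> G (n mod 2) \<Longrightarrow> x = 0 \<or> even (n + dg x)" for x n
    by (cases "even n") (auto simp: deg_def odd_iff_mod_2_eq_one)
  from this[OF br_in[OF assms]] show ?thesis
    unfolding has_deg_def .
qed

text \<open>This lets the signs for a bracket argument be written with its formal degree. If some
  argument is 0, every term vanishes and the signs are immaterial; otherwise \<open>p1\<close>,
  \<open>p2\<close>, \<open>p3\<close> have the parities of the true degrees.\<close>

lemma d1_has_deg:
  assumes f: "Vector_Spaces.linear sc sv f"
    and "has_deg p1 x1" "has_deg p2 x2" "has_deg p3 x3"
  shows "d1 sv G \<delta> br \<theta> f m x1 x2 x3 =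
     sv (sg ((m + p1) * (p2 + p3))) (\<theta> x2 x3 (f x1))
     - f (br x1 x2 x3)
     + sv (\<delta> * sg (m * (p1 + p2))) (D x1 x2 (f x3))
     - sv (\<delta> * sg (p2 * p3 + m * (p1 + p3))) (\<theta> x1 x3 (f x2))"
proof (cases "x1 = 0 \<or> x2 = 0 \<or> x3 = 0")
  case True
  then show ?thesis
    using linear_rules(4)[OF f] by (auto simp: d1_def theta_rules D_rules)
next
  case False
  then have "even p1 \<longleftrightarrow> even (dg x1)" "even p2 \<longleftrightarrow> even (dg x2)" "even p3 \<longleftrightarrow> even (dg x3)"
    using assms by (auto simp: has_deg_def)
  then show ?thesis
    by (simp add: d1_def sg_eq_if)
qed

lemma derivation:
  "hom G a \<Longrightarrow> hom G b \<Longrightarrow> hom G c \<Longrightarrow> hom G d \<Longrightarrow> hom G e \<Longrightarrow>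
     br a b (br c d e) = br (br a b c) d e
       + sc (sg (dg c * (dg a + dg b))) (br c (br a b d) e)
       + sc (\<delta> * sg ((dg a + dg b) * (dg c + dg d))) (br c d (br a b e))"
  using JLSTS unfolding JLSTS_def by blast

lemma R1:
  "hom G a \<Longrightarrow> hom G b \<Longrightarrow> hom G c \<Longrightarrow> hom G d \<Longrightarrow>
     sv (sg ((dg a + dg b) * (dg c + dg d))) (\<theta> c d (\<theta> a b v))
     - sv (\<delta> * sg (dg a * dg b + dg d * (dg c + dg a))) (\<theta> b d (\<theta> a c v))
     - \<theta> a (br b c d) v
     + sv (sg (dg a * (dg b + dg c))) (D b c (\<theta> a d v)) = 0"
  using rep by (simp add: rep_def)

lemma R2:
  "hom G a \<Longrightarrow> hom G b \<Longrightarrow> hom G c \<Longrightarrow> hom G d \<Longrightarrow>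
     sv (\<delta> * sg ((dg a + dg b) * (dg c + dg d))) (\<theta> c d (D a b v))
     - sv \<delta> (D a b (\<theta> c d v))
     + \<theta> (br a b c) d v
     + sv (\<delta> * sg (dg c * (dg a + dg b))) (\<theta> c (br a b d) v) = 0"
  using rep by (simp add: rep_def)

lemma R3:
  "hom G a \<Longrightarrow> hom G b \<Longrightarrow> hom G c \<Longrightarrow> hom G d \<Longrightarrow>
     D (br a b c) d v
     + sv (sg (dg c * (dg a + dg b))) (D c (br a b d) v)
     - sv \<delta> (D a b (D c d v))
     + sv (sg ((dg a + dg b) * (dg c + dg d))) (D c d (D a b v)) = 0"
  using rep by (simp add: rep_def)

text \<open>The degree is an arbitrary natural number \<open>m\<close>, so that it can later be the
  unreduced sum \<open>df + deg G y\<close>.\<close>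

lemma d3_d1_eq_zero:
  assumes f: "Vector_Spaces.linear sc sv f"
    and h: "hom G x1" "hom G x2" "hom G x3" "hom G x4" "hom G x5"
  shows "d3 sv G \<delta> br \<theta> (d1 sv G \<delta> br \<theta> f m) m x1 x2 x3 x4 x5 = 0"
proof -
  define p1 p2 p3 p4 p5 where p: "p1 = dg x1" "p2 = dg x2" "p3 = dg x3" "p4 = dg x4" "p5 = dg x5"
  \<comment> \<open>These are the formal degrees of the four brackets; they make all signs
    polynomial in \<open>m\<close> and \<open>p1\<close> to \<open>p5\<close>.\<close>
  define q3 q4 q5 q where q: "q3 = p1 + p2 + p3" "q4 = p1 + p2 + p4" "q5 = p1 + p2 + p5"
    "q = p3 + p4 + p5"
  note deg = has_deg_dg[of x1, folded p] has_deg_dg[of x2, folded p] has_deg_dg[of x3, folded p]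
    has_deg_dg[of x4, folded p] has_deg_dg[of x5, folded p]
  note deg_br = has_deg_br[OF h(1,2,3), folded p, folded q] has_deg_br[OF h(1,2,4), folded p, folded q]
    has_deg_br[OF h(1,2,5), folded p, folded q] has_deg_br[OF h(3,4,5), folded p, folded q]
  note expand = d1_has_deg[OF f deg(1,2,3)] d1_has_deg[OF f deg(1,2,4)] d1_has_deg[OF f deg(1,2,5)]
    d1_has_deg[OF f deg(3,4,5)] d1_has_deg[OF f deg_br(1) deg(4,5)]
    d1_has_deg[OF f deg(3) deg_br(2) deg(5)] d1_has_deg[OF f deg(3,4) deg_br(3)]
    d1_has_deg[OF f deg(1,2) deg_br(4)]
  note signs = sg_eq_if q V.scale_right_distrib V.scale_right_diff_distrib
  \<comment> \<open>This and the next four equations are solved for one term with a bracket inside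
    an operator, so that they rewrite the expanded sum. The nested scalars are those which the
    expansion of \<open>d3\<close> produces.\<close>
  have x1_terms:
    "sv (sg ((m + p1) * (p2 + q))) (\<theta> x2 (br x3 x4 x5) (f x1)) =
       sv (sg ((m + p1 + p2 + p3) * (p4 + p5))) (sv (sg ((m + p1) * (p2 + p3))) (\<theta> x4 x5 (\<theta> x2 x3 (f x1))))
       - sv (\<delta> * sg ((m + p1 + p2) * (p3 + p5) + p4 * p5)) (sv (sg ((m + p1) * (p2 + p4))) (\<theta> x3 x5 (\<theta> x2 x4 (f x1))))
       + sv (sg ((m + p1 + p2) * (p3 + p4))) (sv (sg ((m + p1) * (p2 + p5))) (D x3 x4 (\<theta> x2 x5 (f x1))))"
    (is "?t = ?r")
  proof -
    \<comment> \<open>The 0 is replaced by the left side of (R1), multiplied by the coefficient of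
      \<open>?t\<close>; the coefficients then agree in each parity case.\<close>
    have "?r - ?t = sv (sg ((m + p1) * (p2 + q))) 0"
      unfolding R1[OF h(2,3,4,5), of "f x1", folded p, symmetric] using delta_cases
      by (cases "even m"; cases "even p1"; cases "even p2"; cases "even p3"; cases "even p4"; cases "even p5"; auto simp: signs)
    then show ?thesis by simp
  qed
  have x2_terms:
    "sv (\<delta> * sg (p2 * q + m * (p1 + q))) (\<theta> x1 (br x3 x4 x5) (f x2)) =
       sv (sg ((m + p1 + p2 + p3) * (p4 + p5))) (sv (\<delta> * sg (p2 * p3 + m * (p1 + p3))) (\<theta> x4 x5 (\<theta> x1 x3 (f x2))))
       - sv (\<delta> * sg ((m + p1 + p2) * (p3 + p5) + p4 * p5)) (sv (\<delta> * sg (p2 * p4 + m * (p1 + p4))) (\<theta> x3 x5 (\<theta> x1 x4 (f x2))))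
       + sv (sg ((m + p1 + p2) * (p3 + p4))) (sv (\<delta> * sg (p2 * p5 + m * (p1 + p5))) (D x3 x4 (\<theta> x1 x5 (f x2))))"
    (is "?t = ?r")
  proof -
    have "?r - ?t = sv (\<delta> * sg (p2 * q + m * (p1 + q))) 0"
      unfolding R1[OF h(1,3,4,5), of "f x2", folded p, symmetric] using delta_cases
      by (cases "even m"; cases "even p1"; cases "even p2"; cases "even p3"; cases "even p4"; cases "even p5"; auto simp: signs)
    then show ?thesis by simp
  qed
  have x3_terms:
    "sv (sg (p3 * (p1 + p2))) (sv (sg ((m + p3) * (q4 + p5))) (\<theta> (br x1 x2 x4) x5 (f x3))) =
       - sv (sg ((m + p1 + p2 + p3) * (p4 + p5))) (sv (\<delta> * sg (m * (p1 + p2))) (\<theta> x4 x5 (D x1 x2 (f x3))))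
       + sv (\<delta> * sg (m * (p1 + p2))) (sv (sg ((m + p3) * (p4 + p5))) (D x1 x2 (\<theta> x4 x5 (f x3))))
       - sv (\<delta> * sg ((p1 + p2) * (p3 + p4))) (sv (sg ((m + p3) * (p4 + q5))) (\<theta> x4 (br x1 x2 x5) (f x3)))"
    (is "?t = ?r")
  proof -
    \<comment> \<open>This exponent is that of \<open>?t\<close> modulo 2: expanding
      \<open>q4\<close> gives a second \<open>p3 * (p1 + p2)\<close>, which cancels the
      first.\<close>
    have "?t - ?r = sv (sg ((m + p3) * (p4 + p5) + m * (p1 + p2))) 0"
      unfolding R2[OF h(1,2,4,5), of "f x3", folded p, symmetric] using delta_cases
      by (cases "even m"; cases "even p1"; cases "even p2"; cases "even p3"; cases "even p4"; cases "even p5"; auto simp: signs)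
    then show ?thesis by simp
  qed
  have x4_terms:
    "sv (\<delta> * sg (p4 * p5 + m * (q3 + p5))) (\<theta> (br x1 x2 x3) x5 (f x4)) =
       - sv (\<delta> * sg ((m + p1 + p2) * (p3 + p5) + p4 * p5)) (sv (\<delta> * sg (m * (p1 + p2))) (\<theta> x3 x5 (D x1 x2 (f x4))))
       + sv (\<delta> * sg (m * (p1 + p2))) (sv (\<delta> * sg (p4 * p5 + m * (p3 + p5))) (D x1 x2 (\<theta> x3 x5 (f x4))))
       - sv (\<delta> * sg ((p1 + p2) * (p3 + p4))) (sv (\<delta> * sg (p4 * q5 + m * (p3 + q5))) (\<theta> x3 (br x1 x2 x5) (f x4)))"
    (is "?t = ?r")
  proof -
    have "?t - ?r = sv (\<delta> * sg (p4 * p5 + m * (q3 + p5))) 0"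
      unfolding R2[OF h(1,2,3,5), of "f x4", folded p, symmetric] using delta_cases
      by (cases "even m"; cases "even p1"; cases "even p2"; cases "even p3"; cases "even p4"; cases "even p5"; auto simp: signs)
    then show ?thesis by simp
  qed
  have x5_terms:
    "sv (\<delta> * sg (m * (q3 + p4))) (D (br x1 x2 x3) x4 (f x5)) =
       sv (\<delta> * sg (m * (p1 + p2))) (sv (\<delta> * sg (m * (p3 + p4))) (D x1 x2 (D x3 x4 (f x5))))
       - sv (sg ((m + p1 + p2) * (p3 + p4))) (sv (\<delta> * sg (m * (p1 + p2))) (D x3 x4 (D x1 x2 (f x5))))
       - sv (sg (p3 * (p1 + p2))) (sv (\<delta> * sg (m * (p3 + q4))) (D x3 (br x1 x2 x4) (f x5)))"
    (is "?t = ?r")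
  proof -
    have "?t - ?r = sv (\<delta> * sg (m * (q3 + p4))) 0"
      unfolding R3[OF h(1,2,3,4), of "f x5", folded p, symmetric] using delta_cases
      by (cases "even m"; cases "even p1"; cases "even p2"; cases "even p3"; cases "even p4"; cases "even p5"; auto simp: signs)
    then show ?thesis by simp
  qed
  \<comment> \<open>An operator on \<open>f\<close> of a bracket arises once from \<open>d3\<close>
    and once from a \<open>d1\<close> with a bracket argument. These identities equate the two
    coefficients; for \<open>D x1 x2\<close> they already coincide.\<close>
  have bracket_terms:
    "sg ((m + q3) * (p4 + p5)) = (sg ((m + p1 + p2 + p3) * (p4 + p5)) :: 'k)"
    "sv (sg (p3 * (p1 + p2))) (sv (\<delta> * sg (q4 * p5 + m * (p3 + p5))) v) =
       sv (\<delta> * sg ((m + p1 + p2) * (p3 + p5) + p4 * p5)) v"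
    "sv (\<delta> * sg ((p1 + p2) * (p3 + p4))) (sv (\<delta> * sg (m * (p3 + p4))) v) =
       sv (sg ((m + p1 + p2) * (p3 + p4))) v" for v
    using delta_cases
    by (cases "even m"; cases "even p1"; cases "even p2"; cases "even p3"; cases "even p4"; cases "even p5"; auto simp: signs)+
  have nested_terms:
    "f (br x1 x2 (br x3 x4 x5)) = f (br (br x1 x2 x3) x4 x5)
       + sv (sg (p3 * (p1 + p2))) (f (br x3 (br x1 x2 x4) x5))
       + sv (\<delta> * sg ((p1 + p2) * (p3 + p4))) (f (br x3 x4 (br x1 x2 x5)))"
    by (simp add: derivation[OF h] linear_rules[OF f] p)
  show ?thesis
    unfolding d3_def p[symmetric] expand theta_rules D_rules V.scale_right_distrib V.scale_right_diff_distrib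
      x1_terms x2_terms x3_terms x4_terms x5_terms bracket_terms nested_terms
    \<comment> \<open>Nested scalars stay unmerged, so that opposite terms remain syntactically
      equal and cancel.\<close>
    by (simp add: algebra_simps del: V.scale_scale)
qed

end

text \<open>Only \<open>y\<close> is applied here, because the cochain inside \<open>d4\<close>
  becomes a function of the remaining arguments once \<open>y\<close> is fixed.\<close>

lemma d2_eq_d1: "d2 sv G \<delta> br \<theta> f m y = d1 sv G \<delta> br \<theta> (f y) (m + deg G y)"
  by (intro ext) (simp add: d2_def d1_def)

lemma d4_eq_d3: "d4 sv G \<delta> br \<theta> g m y = d3 sv G \<delta> br \<theta> (g y) (m + deg G y)"
  by (intro ext) (simp add: d4_def d3_def)

theorem theorem3p7:
  fixes sc :: "'k::field \<Rightarrow> 'a::ab_group_add \<Rightarrow> 'a"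
    and sv :: "'k \<Rightarrow> 'v::ab_group_add \<Rightarrow> 'v"
    and G :: "nat \<Rightarrow> 'a set" and VG :: "nat \<Rightarrow> 'v set"
    and \<delta> :: 'k and br :: "'a \<Rightarrow> 'a \<Rightarrow> 'a \<Rightarrow> 'a" and \<theta> :: "'a \<Rightarrow> 'a \<Rightarrow> 'v \<Rightarrow> 'v"
  assumes "JLSTS sc G \<delta> br"
    and "rep sc G \<delta> br sv VG \<theta>"
  shows "(\<forall>f df. hom_linear sc G sv VG f df \<longrightarrow>
            (\<forall>x1 x2 x3 x4 x5. hom G x1 \<longrightarrow> hom G x2 \<longrightarrow> hom G x3 \<longrightarrow> hom G x4 \<longrightarrow> hom G x5 \<longrightarrow>
               d3 sv G \<delta> br \<theta> (d1 sv G \<delta> br \<theta> f df) df x1 x2 x3 x4 x5 = 0))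
       \<and> (\<forall>f df. cochain2 sc G \<delta> sv VG f df \<longrightarrow>
            (\<forall>y x1 x2 x3 x4 x5. hom G y \<longrightarrow> hom G x1 \<longrightarrow> hom G x2 \<longrightarrow> hom G x3 \<longrightarrow> hom G x4 \<longrightarrow> hom G x5 \<longrightarrow>
               d4 sv G \<delta> br \<theta> (d2 sv G \<delta> br \<theta> f df) df y x1 x2 x3 x4 x5 = 0))"
proof -
  interpret JLSTS_rep sc sv G VG \<delta> br \<theta>
    using assms by unfold_locales
  show ?thesis
    unfolding d2_eq_d1 d4_eq_d3 hom_linear_def cochain2_def by (blast intro: d3_d1_eq_zero)
qed

end
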